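(* Let $K$ be a preradicable (commutative, infinite) idempotent semifield, and let $p, q \in K[X]$. If one of the following conditions holds: (1) $\deg p < \deg q$, or (2) $\operatorname{val} p > \operatorname{val} q$, then the inequality $\widehat{p}(x) \leqslant \widehat{q}(x)$ has a non-zero solution $x$ in $K$.
   Context: A semiring is a commutative monoid $(S,+,0)$ with an associative multiplication having identity $1$, distributing over $+$, and with $0$ absorbing. A semifield is a semiring with $1\neq 0$ in which every nonzero element has a multiplicative inverse; it is idempotent if $x+x=x$ for all $x$. All idempotent semifields are assumed commutative and infinite. An idempotent semifield $K$ is ordered by $x\leqslant y \iff x+y=y$. $\mathbb{N}$ contains $0$ and $\mathbb{N}^*=\mathbb{N}\setminus\{0\}$. $K$ is preradicable if for all $y\in K$, $n\in\mathbb{N}^*$ there is a least element $x\in K$ with $x^n\geqslant y$. A polynomial $p\in K[X]$ is a formal polynomial $p=\sum_{j\in\mathbb{N}}p_jX^j$ (eventually zero sequence of coefficients), with polynomial function $\widehat p:K\to K$, $\widehat p(x)=\sum_j p_jx^j$. The degree $\deg p$ and valuation $\operatorname{val}p$ are the maximum and minimum of $\{j:p_j\neq0\}$, with $\deg 0=-\infty$ and $\operatorname{val}0=\infty$. *)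

theory Defs
  imports
    "HOL-Computational_Algebra.Polynomial"
    "HOL-Library.Extended"
    "HOL-Library.Infinite_Typeclass"
begin

text \<open>
  The class \<^class>\<open>comm_semiring_1\<close> supplies commutativity, \<open>0 \<noteq> 1\<close> and the absorption laws
  for \<open>0\<close>. Following the convention that all idempotent semifields are infinite, finiteness of
  the carrier is excluded in the class itself.
\<close>

class idempotent_semifield = comm_semiring_1 + ord + infinite +
  assumes ex_right_inverse: "x \<noteq> 0 \<Longrightarrow> \<exists>y. x * y = 1"
    and add_idem: "x + x = x"
    and le_iff_add_eq: "x \<le> y \<longleftrightarrow> x + y = y"
    and less_iff_le_neq: "x < y \<longleftrightarrow> x \<le> y \<and> x \<noteq> y"
begin

subclass order
proof
  fix x y z :: 'a
  show "x \<le> x"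
    by (simp add: le_iff_add_eq add_idem)
  show antisym: "x = y" if "x \<le> y" "y \<le> x"
    using that by (simp add: le_iff_add_eq add.commute)
  show "x < y \<longleftrightarrow> x \<le> y \<and> \<not> y \<le> x"
    by (metis less_iff_le_neq le_iff_add_eq add.commute add_idem)
  show "x \<le> z" if "x \<le> y" "y \<le> z"
    using that by (metis le_iff_add_eq add.assoc)
qed

end

class preradicable_idempotent_semifield = idempotent_semifield +
  assumes ex_least_power_ge:
    "n > 0 \<Longrightarrow> \<exists>x. y \<le> x ^ n \<and> (\<forall>z. y \<le> z ^ n \<longrightarrow> x \<le> z)"

text \<open>
  The library function \<^const>\<open>degree\<close> has \<open>degree 0 = 0\<close>; here the zero polynomial has degree
  \<open>-\<infinity>\<close> and valuation \<open>\<infinity>\<close>.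
\<close>

definition deg :: "'a::zero poly \<Rightarrow> nat extended" where
  "deg p = (if p = 0 then -\<infinity> else Fin (degree p))"

definition val :: "'a::zero poly \<Rightarrow> nat extended" where
  "val p = (if p = 0 then \<infinity> else Fin (Min {j. coeff p j \<noteq> 0}))"

lemma deg_eq_Max: "p \<noteq> 0 \<Longrightarrow> deg p = Fin (Max {j. coeff p j \<noteq> 0})"
proof -
  assume "p \<noteq> 0"
  have "finite {j. coeff p j \<noteq> 0}"
    by (rule finite_subset[of _ "{..degree p}"]) (auto intro: le_degree)
  then have "Max {j. coeff p j \<noteq> 0} = degree p"
    using \<open>p \<noteq> 0\<close> by (intro Max_eqI) (auto intro: le_degree)
  then show ?thesis
    using \<open>p \<noteq> 0\<close> by (simp add: deg_def)
qed

end

theory Submission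
  imports Defs
begin

text \<open>
  If \<open>b\<close> is the leading (resp. lowest) coefficient of \<open>q\<close>, put \<open>s = 1 + (\<Sum>i. p\<^sub>i / b)\<close>, so that
  \<open>1 \<le> s\<close> and \<open>p\<^sub>i \<le> s b\<close> for all \<open>i\<close>. Since the powers of \<open>s\<close> increase and those of \<open>1 / s\<close>
  decrease, the term of \<open>q\<close> with coefficient \<open>b\<close> dominates every term of \<open>p\<close> at \<open>x = s\<close>
  (resp. \<open>x = 1 / s\<close>).
\<close>

context idempotent_semifield
begin

lemma zero_least: "0 \<le> x"
  by (simp add: le_iff_add_eq)

lemma add_upper1: "x \<le> x + y"
  by (simp add: le_iff_add_eq add_idem add.assoc[symmetric])

lemma add_upper2: "y \<le> x + y"
  using add_upper1[of y x] by (simp add: add.commute)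

lemma add_least: "x \<le> z \<Longrightarrow> y \<le> z \<Longrightarrow> x + y \<le> z"
  by (simp add: le_iff_add_eq add.assoc)

lemma mult_left_mono_le: "x \<le> y \<Longrightarrow> z * x \<le> z * y"
  by (simp add: le_iff_add_eq flip: distrib_left)

lemma mult_right_mono_le: "x \<le> y \<Longrightarrow> x * z \<le> y * z"
  by (simp add: le_iff_add_eq flip: distrib_right)

text \<open>Addition is the join of the order and 0 its bottom element, so finite sums are suprema.
  The bound also covers infinite \<open>A\<close>, where \<open>sum\<close> defaults to 0.\<close>

lemma sum_least: "(\<And>i. i \<in> A \<Longrightarrow> f i \<le> z) \<Longrightarrow> sum f A \<le> z"
  by (induction A rule: infinite_finite_induct) (auto intro: add_least zero_least)

lemma sum_upper: "finite A \<Longrightarrow> i \<in> A \<Longrightarrow> f i \<le> sum f A"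
  by (simp add: sum.remove add_upper1)

lemma power_increasing_le:
  assumes "1 \<le> x" "m \<le> n"
  shows "x ^ m \<le> x ^ n"
  using \<open>m \<le> n\<close>
proof (induction n rule: dec_induct)
  case (step n)
  from mult_right_mono_le[OF \<open>1 \<le> x\<close>, of "x ^ n"] step.IH show ?case
    by (auto intro: order.trans)
qed simp

lemma power_decreasing_le:
  assumes "x \<le> 1" "m \<le> n"
  shows "x ^ n \<le> x ^ m"
  using \<open>m \<le> n\<close>
proof (induction n rule: dec_induct)
  case (step n)
  from mult_right_mono_le[OF \<open>x \<le> 1\<close>, of "x ^ n"] step.IH show ?case
    by (auto intro: order.trans)
qed simp

lemma nonzero_if_ge_one: "1 \<le> x \<Longrightarrow> x \<noteq> 0"
  by (auto simp: le_iff_add_eq)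

end

lemma monomial_le_poly:
  fixes q :: "'a::idempotent_semifield poly"
  shows "coeff q n * x ^ n \<le> poly q x"
proof (cases "n \<le> degree q")
  case True
  then show ?thesis
    unfolding poly_altdef by (intro sum_upper) auto
qed (simp add: coeff_eq_0 zero_least)

text \<open>Vanishing coefficients contribute only the bottom element 0, so the bound is asked for
  only where the hypotheses on degree or valuation say something about \<open>i\<close>.\<close>

lemma poly_le:
  fixes p :: "'a::idempotent_semifield poly"
  assumes "\<And>i. coeff p i \<noteq> 0 \<Longrightarrow> coeff p i * x ^ i \<le> z"
  shows "poly p x \<le> z"
  unfolding poly_altdef
proof (rule sum_least)
  show "coeff p i * x ^ i \<le> z" for i
    using assms[of i] by (cases "coeff p i = 0") (auto simp: zero_least)
qed

lemma coeff_bound: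
  fixes p :: "'a::idempotent_semifield poly"
  assumes "b \<noteq> 0"
  obtains s where "1 \<le> s" "\<And>i. coeff p i \<le> s * b"
proof -
  obtain c where c: "b * c = 1"
    using ex_right_inverse[OF assms] by blast
  \<comment> \<open>\<open>poly p 1\<close> is the sum of all coefficients of \<open>p\<close>,
    hence an upper bound of each, and \<open>c\<close> is the inverse of \<open>b\<close>. The
    summand 1 makes \<open>s\<close> nonzero even for \<open>p = 0\<close> and its powers
    increasing.\<close>
  define s where "s = 1 + poly p 1 * c"
  have "coeff p i \<le> s * b" for i
  proof -
    have "coeff p i \<le> poly p 1"
      using monomial_le_poly[of p i 1] by simp
    also have "\<dots> = poly p 1 * c * b"
      by (simp add: c mult.assoc mult.commute[of c])
    also have "\<dots> \<le> s * b"
      unfolding s_def by (intro mult_right_mono_le add_upper2)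
    finally show ?thesis .
  qed
  moreover have "1 \<le> s"
    unfolding s_def by (rule add_upper1)
  ultimately show thesis
    using that by blast
qed

lemma poly_le_if_degree_less:
  fixes p q :: "'a::idempotent_semifield poly"
  assumes "coeff q n \<noteq> 0" and less: "\<And>i. coeff p i \<noteq> 0 \<Longrightarrow> i < n"
  shows "\<exists>x. x \<noteq> 0 \<and> poly p x \<le> poly q x"
proof -
  obtain s where s: "1 \<le> s" "\<And>i. coeff p i \<le> s * coeff q n"
    using coeff_bound[OF assms(1)] by blast
  have "poly p s \<le> coeff q n * s ^ n"
  proof (rule poly_le)
    fix i assume "coeff p i \<noteq> 0"
    have "coeff p i * s ^ i \<le> s * coeff q n * s ^ i"
      by (intro mult_right_mono_le s)
    \<comment> \<open>The strict inequality \<open>i < n\<close> leaves room for exactly this extra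
      factor \<open>s\<close>.\<close>
    also have "\<dots> = coeff q n * s ^ Suc i"
      by (simp add: ac_simps)
    also have "\<dots> \<le> coeff q n * s ^ n"
      using less[OF \<open>coeff p i \<noteq> 0\<close>] s(1)
      by (intro mult_left_mono_le power_increasing_le) auto
    finally show "coeff p i * s ^ i \<le> coeff q n * s ^ n" .
  qed
  also have "\<dots> \<le> poly q s"
    by (rule monomial_le_poly)
  finally show ?thesis
    using nonzero_if_ge_one[OF s(1)] by blast
qed

lemma poly_le_if_valuation_greater:
  fixes p q :: "'a::idempotent_semifield poly"
  assumes "coeff q m \<noteq> 0" and less: "\<And>i. coeff p i \<noteq> 0 \<Longrightarrow> m < i"
  shows "\<exists>x. x \<noteq> 0 \<and> poly p x \<le> poly q x"
proof -
  obtain s where s: "1 \<le> s" "\<And>i. coeff p i \<le> s * coeff q m"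
    using coeff_bound[OF assms(1)] by blast
  obtain x where x: "s * x = 1"
    using ex_right_inverse[OF nonzero_if_ge_one[OF s(1)]] by blast
  \<comment> \<open>Multiplying \<open>1 \<le> s\<close> by its inverse \<open>x\<close> reverses
    the inequality.\<close>
  have "x \<le> 1"
    using mult_right_mono_le[OF s(1), of x] x by simp
  have "poly p x \<le> coeff q m * x ^ m"
  proof (rule poly_le)
    fix i assume "coeff p i \<noteq> 0"
    \<comment> \<open>Since \<open>i > m\<close>, one factor \<open>x\<close> can be split off
      \<open>x ^ i\<close> to cancel \<open>s\<close>, and the remaining exponent \<open>k\<close>
      is still at least \<open>m\<close>.\<close>
    then obtain k where k: "i = Suc k" "m \<le> k"
      using less[of i] by (metis less_Suc_eq_le less_imp_Suc_add le_add1)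
    have "coeff p i * x ^ i \<le> s * coeff q m * x ^ i"
      by (intro mult_right_mono_le s)
    also have "\<dots> = (s * x) * (coeff q m * x ^ k)"
      by (simp add: k ac_simps)
    also have "\<dots> \<le> coeff q m * x ^ m"
      using k \<open>x \<le> 1\<close> by (simp add: x mult_left_mono_le power_decreasing_le)
    finally show "coeff p i * x ^ i \<le> coeff q m * x ^ m" .
  qed
  also have "\<dots> \<le> poly q x"
    by (rule monomial_le_poly)
  finally have "poly p x \<le> poly q x" .
  moreover have "x \<noteq> 0"
    using x by auto
  ultimately show ?thesis
    by blast
qed

text \<open>For nonzero \<open>p\<close> the leading coefficient is the decisive one. For
  \<open>p = 0\<close> the condition on \<open>i\<close> is vacuous, in agreement with degree
  -\<infinity>, so it also covers a nonzero constant \<open>q\<close>.\<close>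

lemma deg_less_iff:
  "deg p < deg q \<longleftrightarrow> q \<noteq> 0 \<and> (\<forall>i. coeff p i \<noteq> 0 \<longrightarrow> i < degree q)"
  by (cases "p = 0"; cases "q = 0") (auto simp: deg_def intro: le_less_trans le_degree)

lemma finite_nonzero_coeffs: "finite {j. coeff p j \<noteq> 0}"
  using MOST_coeff_eq_0[of p] by (simp add: MOST_iff_cofinite)

lemma val_lessE:
  assumes "val q < val p"
  obtains m where "coeff q m \<noteq> 0" "\<And>i. coeff p i \<noteq> 0 \<Longrightarrow> m < i"
proof -
  let ?S = "{j. coeff q j \<noteq> 0}"
  \<comment> \<open>Otherwise \<open>val q\<close> would be \<infinity>, the greatest value. The
    witness \<open>m\<close> is the valuation of \<open>q\<close>; for \<open>p = 0\<close> nothing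
    remains to be shown about \<open>i\<close>.\<close>
  have "q \<noteq> 0"
    using assms by (auto simp: val_def)
  then have "?S \<noteq> {}"
    by (auto simp: poly_eq_iff)
  then have "Min ?S \<in> ?S"
    by (intro Min_in finite_nonzero_coeffs)
  moreover have "Min ?S < i" if "coeff p i \<noteq> 0" for i
  proof -
    have "p \<noteq> 0"
      using that by auto
    then have "Min ?S < Min {j. coeff p j \<noteq> 0}"
      using assms \<open>q \<noteq> 0\<close> by (simp add: val_def)
    also have "\<dots> \<le> i"
      using that by (intro Min_le finite_nonzero_coeffs) simp
    finally show ?thesis .
  qed
  ultimately show thesis
    using that by blast
qed

theorem proposition6p2:
  fixes p q :: "'a::preradicable_idempotent_semifield poly"
  assumes "deg p < deg q \<or> val p > val q"
  shows "\<exists>x. x \<noteq> 0 \<and> poly p x \<le> poly q x"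
  using assms
proof
  assume "deg p < deg q"
  then have "coeff q (degree q) \<noteq> 0" "\<And>i. coeff p i \<noteq> 0 \<Longrightarrow> i < degree q"
    unfolding deg_less_iff by auto
  then show ?thesis
    by (rule poly_le_if_degree_less)
next
  assume "val q < val p"
  then obtain m where "coeff q m \<noteq> 0" "\<And>i. coeff p i \<noteq> 0 \<Longrightarrow> m < i"
    by (rule val_lessE) blast
  then show ?thesis
    by (rule poly_le_if_valuation_greater)
qed

end
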